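(* Consider the variety with no axioms in the language with a single unary function symbol $f$, and presentations with a single generator $a$ and a single identity $f^{(r)}(a)=f^{(r')}(a)$, $r,r'\ge 0$. Let $\mathcal{A}$ be the structure that is the disjoint union of (i) an $\omega$-chain and (ii) a component consisting of two $\omega^*$-chains and one $\omega$-chain that come together at a special point, this point being the end of both $\omega^*$-chains and the beginning of the $\omega$-chain. Then every elementary first-order sentence $\varphi$ in the language $\{f\}$ that is true in $\mathcal{A}$ has limiting density $1$.
   Context: Explicitly, $\mathcal{A}$ has distinct elements $b_i$ ($i\ge 0$), $c_i$ ($i\ge0$), $d_i$ ($i\ge 1$), $e_i$ ($i\ge1$), with $f(b_i)=b_{i+1}$, $f(c_i)=c_{i+1}$, $f(d_{i+1})=d_i$, $f(e_{i+1})=e_i$, and $f(d_1)=f(e_1)=c_0$; the special point is $c_0$. The structure given by a presentation with generator $a$ and identity $f^{(r)}(a)=f^{(r')}(a)$ is the structure generated by $a$ in which the equations between terms $f^{(i)}(a)$ that hold are exactly the logical consequences of the identity. Identities are counted as ordered pairs $(r,r')$, and the length of the identity is $r+r'$. Let $P_s$ be the number of identities of length at most $s$ and $P_s(\varphi)$ the number of these whose resulting structure satisfies $\varphi$. The sentence $\varphi$ has limiting density $d$ if $\lim_{s\to\infty}P_s(\varphi)/P_s=d$. *)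

theory Defs
  imports Complex_Main
begin

section \<open>First-order logic over one unary function symbol\<close>

datatype 'v tm = Var 'v | Fn "'v tm"

datatype fm =
    Eq "nat tm" "nat tm"
  | Neg fm
  | Conj fm fm
  | Ex nat fm

primrec tm_vars :: "'v tm \<Rightarrow> 'v set" where
  "tm_vars (Var x) = {x}"
| "tm_vars (Fn t) = tm_vars t"

primrec free_vars :: "fm \<Rightarrow> nat set" where
  "free_vars (Eq s t) = tm_vars s \<union> tm_vars t"
| "free_vars (Neg \<phi>) = free_vars \<phi>"
| "free_vars (Conj \<phi> \<psi>) = free_vars \<phi> \<union> free_vars \<psi>"
| "free_vars (Ex x \<phi>) = free_vars \<phi> - {x}"

definition sentence :: "fm \<Rightarrow> bool" where
  "sentence \<phi> \<longleftrightarrow> free_vars \<phi> = {}"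

record 'a struct =
  univ :: "'a set"
  func :: "'a \<Rightarrow> 'a"

definition is_struct :: "'a struct \<Rightarrow> bool" where
  "is_struct S \<longleftrightarrow> univ S \<noteq> {} \<and> func S ` univ S \<subseteq> univ S"

primrec eval_tm :: "'a struct \<Rightarrow> ('v \<Rightarrow> 'a) \<Rightarrow> 'v tm \<Rightarrow> 'a" where
  "eval_tm S e (Var x) = e x"
| "eval_tm S e (Fn t) = func S (eval_tm S e t)"

primrec sat :: "'a struct \<Rightarrow> (nat \<Rightarrow> 'a) \<Rightarrow> fm \<Rightarrow> bool" where
  "sat S e (Eq s t) \<longleftrightarrow> eval_tm S e s = eval_tm S e t"
| "sat S e (Neg \<phi>) \<longleftrightarrow> \<not> sat S e \<phi>"
| "sat S e (Conj \<phi> \<psi>) \<longleftrightarrow> sat S e \<phi> \<and> sat S e \<psi>"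
| "sat S e (Ex x \<phi>) \<longleftrightarrow> (\<exists>a\<in>univ S. sat S (e(x := a)) \<phi>)"

definition models :: "'a struct \<Rightarrow> fm \<Rightarrow> bool" where
  "models S \<phi> \<longleftrightarrow> (\<forall>e. range e \<subseteq> univ S \<longrightarrow> sat S e \<phi>)"


section \<open>Presentations\<close>

text \<open>The generators are treated as constants, so there is no substitution rule.
  The lemmas \<open>conseq_sound\<close> and \<open>eval_presented\<close> below show that these rules derive exactly
  the equations that are semantic consequences of \<open>E\<close>.\<close>

inductive conseq :: "('v tm \<times> 'v tm) set \<Rightarrow> 'v tm \<Rightarrow> 'v tm \<Rightarrow> bool"
  for E :: "('v tm \<times> 'v tm) set" where
  ax: "(s, t) \<in> E \<Longrightarrow> conseq E s t"
| refl: "conseq E t t"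
| sym: "conseq E s t \<Longrightarrow> conseq E t s"
| trans: "conseq E s t \<Longrightarrow> conseq E t u \<Longrightarrow> conseq E s u"
| cong: "conseq E s t \<Longrightarrow> conseq E (Fn s) (Fn t)"

definition conseq_rel :: "('v tm \<times> 'v tm) set \<Rightarrow> ('v tm \<times> 'v tm) set" where
  "conseq_rel E = {(s, t). conseq E s t}"

text \<open>The type \<open>'v\<close> is the set of generators; \<open>func\<close> maps the class of \<open>t\<close> to the class
  of \<open>Fn t\<close>.\<close>

definition presented :: "('v tm \<times> 'v tm) set \<Rightarrow> 'v tm set struct" where
  "presented E = \<lparr> univ = UNIV // conseq_rel E, func = (\<lambda>X. conseq_rel E `` (Fn ` X)) \<rparr>"

lemma conseq_sound:
  assumes "conseq E s t"
    and "\<And>u v. (u, v) \<in> E \<Longrightarrow> eval_tm S e u = eval_tm S e v"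
  shows "eval_tm S e s = eval_tm S e t"
  using assms(1) by induction (auto simp: assms(2))

lemma equiv_conseq_rel: "equiv UNIV (conseq_rel E)"
  by (rule equivI)
    (auto simp: conseq_rel_def refl_on_def sym_def trans_def
      intro: conseq.refl conseq.sym conseq.trans)

lemma func_presented_class:
  "func (presented E) (conseq_rel E `` {t}) = conseq_rel E `` {Fn t}"
  by (auto simp: presented_def conseq_rel_def image_iff
      intro: conseq.refl conseq.trans conseq.cong)

lemma eval_tm_presented:
  "eval_tm (presented E) (\<lambda>v. conseq_rel E `` {Var v}) t = conseq_rel E `` {t}"
  by (induction t) (simp_all add: func_presented_class)

lemma eval_presented:
  "eval_tm (presented E) (\<lambda>v. conseq_rel E `` {Var v}) s
     = eval_tm (presented E) (\<lambda>v. conseq_rel E `` {Var v}) t \<longleftrightarrow> conseq E s t"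
  unfolding eval_tm_presented
  using eq_equiv_class_iff[OF equiv_conseq_rel, of s t E] by (simp add: conseq_rel_def)

lemma presented_generated:
  "univ (presented E) = range (eval_tm (presented E) (\<lambda>v. conseq_rel E `` {Var v}))"
  unfolding eval_tm_presented by (auto simp: presented_def quotient_def)

lemma is_struct_presented: "is_struct (presented E)"
  unfolding is_struct_def presented_generated
  by (auto simp: eval_tm_presented func_presented_class)

definition one_identity :: "nat \<Rightarrow> nat \<Rightarrow> unit tm set struct" where
  "one_identity r r' = presented {((Fn ^^ r) (Var ()), (Fn ^^ r') (Var ()))}"


section \<open>Limiting density\<close>

definition num_identities :: "nat \<Rightarrow> nat" where
  "num_identities s = card {(r, r'). r + r' \<le> s}"

definition num_identities_sat :: "fm \<Rightarrow> nat \<Rightarrow> nat" where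
  "num_identities_sat \<phi> s = card {(r, r'). r + r' \<le> s \<and> models (one_identity r r') \<phi>}"

definition has_limiting_density :: "fm \<Rightarrow> real \<Rightarrow> bool" where
  "has_limiting_density \<phi> d \<longleftrightarrow>
     (\<lambda>s. real (num_identities_sat \<phi> s) / real (num_identities s)) \<longlonglongrightarrow> d"

text \<open>Both counts are cardinalities of finite sets, so \<open>card\<close> does not take its junk value.\<close>

lemma finite_identities: "finite {(r :: nat, r'). r + r' \<le> s}"
  by (rule finite_subset[of _ "{..s} \<times> {..s}"]) auto


section \<open>The limiting structure\<close>

datatype limit_elem = B nat | C nat | D nat | E nat

text \<open>\<open>D 0\<close> and \<open>E 0\<close> lie outside the universe; their images are irrelevant.\<close>

fun limit_func :: "limit_elem \<Rightarrow> limit_elem" where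
  "limit_func (B i) = B (Suc i)"
| "limit_func (C i) = C (Suc i)"
| "limit_func (D i) = (if i = 1 then C 0 else D (i - 1))"
| "limit_func (E i) = (if i = 1 then C 0 else E (i - 1))"

definition limit_struct :: "limit_elem struct" where
  "limit_struct = \<lparr> univ = range B \<union> range C \<union> D ` {1..} \<union> E ` {1..}, func = limit_func \<rparr>"

lemma is_struct_limit_struct: "is_struct limit_struct"
  by (auto simp: is_struct_def limit_struct_def)

end

theory Submission imports Defs begin

text \<open>
  For \<open>r < r'\<close> the presented structure is a tail of length \<open>r\<close> running into a cycle of length
  \<open>r' - r\<close>. If \<open>M \<le> r\<close> and \<open>M \<le> r' - r\<close>, then within distance \<open>M\<close> it cannot be told apart
  from the limit structure: both have one point without preimage and one point with two preimages,
  which are far from each other, and they look like a line elsewhere. An Ehrenfeucht-Fraisse game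
  started at these special points, whose invariant is that \<open>f\<^sup>n x = x'\<close> holds simultaneously on
  both sides for all \<open>n\<close> up to a radius that is halved in each round, shows that a fixed sentence
  has the same truth value in both structures once \<open>M\<close> is large. The remaining identities are
  \<open>O(s)\<close> among about \<open>s\<^sup>2 / 2\<close>.
\<close>

section \<open>Functions with a single branching point\<close>

text \<open>\<open>b\<close> starts a chain and \<open>c\<close> is where two chains merge, through
  \<open>d\<close> and \<open>e\<close>. \<open>M\<close> is the scale up to which this picture is
  guaranteed: beyond it \<open>b\<close> may run into \<open>c\<close> and cycles may close
  up.\<close>

locale lollipop =
  fixes U :: "'a set" and f :: "'a \<Rightarrow> 'a" and b c d e :: 'a and M :: nat
  assumes closed: "x \<in> U \<Longrightarrow> f x \<in> U"
    and b_in: "b \<in> U" and c_in: "c \<in> U" and d_in: "d \<in> U" and e_in: "e \<in> U"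
    and inj_off_c: "\<lbrakk>u \<in> U; v \<in> U; f u = f v; f u \<noteq> c\<rbrakk> \<Longrightarrow> u = v"
    and pre_c: "\<lbrakk>u \<in> U; f u = c\<rbrakk> \<Longrightarrow> u = d \<or> u = e"
    and f_d: "f d = c" and f_e: "f e = c" and d_neq_e: "d \<noteq> e"
    and no_pre_b: "u \<in> U \<Longrightarrow> f u \<noteq> b"
    and pre_ex: "\<lbrakk>u \<in> U; u \<noteq> b\<rbrakk> \<Longrightarrow> \<exists>v\<in>U. f v = u"
    and b_far_c: "n < M \<Longrightarrow> (f ^^ n) b \<noteq> c"
    and no_short_cycle: "\<lbrakk>x \<in> U; 0 < n; n < M\<rbrakk> \<Longrightarrow> (f ^^ n) x \<noteq> x"
begin

section \<open>Iterates of a map that merges points only at \<open>c\<close>\<close>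

lemma funpow_closed: "x \<in> U \<Longrightarrow> (f ^^ n) x \<in> U"
  by (induction n) (auto intro: closed)

lemma funpow_neq_b:
  assumes "u \<in> U" "0 < n"
  shows "(f ^^ n) u \<noteq> b"
  using assms by (cases n) (auto simp: no_pre_b funpow_closed)

text \<open>Off \<open>c\<close> the map is injective, so applications of \<open>f\<close> can be
  stripped from the outside as long as the common value is not \<open>c\<close>.\<close>

lemma funpow_cancel:
  assumes "u \<in> U" "v \<in> U" "(f ^^ n) u = (f ^^ n) v"
    and "\<And>t. \<lbrakk>0 < t; t \<le> n\<rbrakk> \<Longrightarrow> (f ^^ t) u \<noteq> c"
  shows "u = v"
  using assms(3,4)
proof (induction n)
  case (Suc n)
  have "f ((f ^^ n) u) = f ((f ^^ n) v)" "f ((f ^^ n) u) \<noteq> c"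
    using Suc.prems(1) Suc.prems(2)[of "Suc n"] by simp_all
  with assms(1,2) have "(f ^^ n) u = (f ^^ n) v"
    by (rule inj_off_c[OF funpow_closed funpow_closed])
  then show ?case by (rule Suc.IH) (rule Suc.prems(2), simp_all)
qed simp

text \<open>Strip \<open>f\<close> from both sides until one exponent is used up or the common value
  is \<open>c\<close>; \<open>k\<close> counts the stripped applications. Equations between iterates
  thus reduce to conditions \<open>(f ^^ m) z = z'\<close>, the kind that the game invariant
  controls.\<close>

lemma funpow_eq_iff:
  assumes "u \<in> U" "v \<in> U"
  shows "(f ^^ l) u = (f ^^ n) v \<longleftrightarrow>
    (l \<le> n \<and> (f ^^ (n - l)) v = u) \<or> (n \<le> l \<and> (f ^^ (l - n)) u = v) \<or>
    (\<exists>k. k \<le> l \<and> k \<le> n \<and> (f ^^ (l - k)) u = c \<and> (f ^^ (n - k)) v = c)" (is "_ \<longleftrightarrow> ?R l n")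
proof
  assume "(f ^^ l) u = (f ^^ n) v"
  then show "?R l n"
  proof (induction l arbitrary: n)
    case (Suc l)
    show ?case
    proof (cases n)
      case 0
      then show ?thesis using Suc.prems by auto
    next
      case n: (Suc m)
      show ?thesis
      proof (cases "(f ^^ Suc l) u = c")
        case True
        then show ?thesis using Suc.prems by (intro disjI2 exI[of _ 0]) auto
      next
        case False
        then have "(f ^^ l) u = (f ^^ m) v"
          using Suc.prems assms n by (simp add: inj_off_c funpow_closed)
        from Suc.IH[OF this] show ?thesis
        proof (elim disjE exE conjE)
          fix k assume "k \<le> l" "k \<le> m" "(f ^^ (l - k)) u = c" "(f ^^ (m - k)) v = c"
          then show ?thesis unfolding n by (intro disjI2 exI[of _ "Suc k"]) simp
        qed (simp_all add: n)
      qed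
    qed
  qed simp
next
  have split: "(f ^^ l) x = (f ^^ k) ((f ^^ (l - k)) x)" if "k \<le> l" for k l x
    using that by (simp flip: funpow_add comp_apply[of "f ^^ k"])
  assume "?R l n"
  then show "(f ^^ l) u = (f ^^ n) v"
    by (elim disjE exE conjE) (metis split)+
qed

text \<open>Before time \<open>M\<close> the orbit of \<open>b\<close> avoids \<open>c\<close>, so
  nothing merges into it, and \<open>b\<close> has no preimage.\<close>

lemma funpow_eq_orbit_b:
  assumes "u \<in> U" "t < M" "(f ^^ n) u = (f ^^ t) b"
  shows "n \<le> t \<and> u = (f ^^ (t - n)) b"
proof -
  consider "n \<le> t" "(f ^^ (t - n)) b = u" | "t < n" "(f ^^ (n - t)) u = b"
    | "t = n" "u = b" | k where "(f ^^ (t - k)) b = c"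
    using assms(3) unfolding funpow_eq_iff[OF assms(1) b_in] by (auto simp: le_less)
  then show ?thesis
  proof cases
    case 2
    then show ?thesis using funpow_neq_b[OF assms(1), of "n - t"] by simp
  next
    case 4
    then show ?thesis using b_far_c[of "t - k"] assms(2) by simp
  qed auto
qed

lemma inj_on_orbit_b: "inj_on (\<lambda>t. (f ^^ t) b) {..<M}"
proof (rule inj_onI)
  fix s t assume "s \<in> {..<M}" "t \<in> {..<M}" "(f ^^ s) b = (f ^^ t) b"
  then show "s = t"
    using funpow_eq_orbit_b[OF b_in, of t s] funpow_eq_orbit_b[OF b_in, of s t] by auto
qed

text \<open>The first \<open>M\<close> points of the orbit of \<open>b\<close> are distinct. Each of
  them in \<open>X\<close> rules out at most \<open>2 * K + 1\<close> times around its own, so by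
  counting some time \<open>t < M - K\<close> survives.\<close>

lemma far_element:
  assumes "finite X" and card: "card X * (2 * K + 1) + K < M"
  obtains y where "y \<in> U" "\<And>n z. \<lbrakk>n \<le> K; z \<in> X\<rbrakk> \<Longrightarrow> (f ^^ n) y \<noteq> z"
    "\<And>n z. \<lbrakk>n \<le> K; z \<in> X; z \<in> U\<rbrakk> \<Longrightarrow> (f ^^ n) z \<noteq> y"
proof -
  define I where "I = {t \<in> {..<M}. (f ^^ t) b \<in> X}"
  have fin: "finite I" by (simp add: I_def)
  have "card I = card ((\<lambda>t. (f ^^ t) b) ` I)"
    by (rule card_image[symmetric], rule inj_on_subset[OF inj_on_orbit_b]) (auto simp: I_def)
  also have "\<dots> \<le> card X"
    by (rule card_mono[OF assms(1)]) (auto simp: I_def)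
  finally have cI: "card I \<le> card X" .
  have "card (\<Union>i\<in>I. {i - K..i + K}) \<le> (\<Sum>i\<in>I. card {i - K..i + K})"
    by (rule card_UN_le[OF fin])
  also have "\<dots> \<le> (\<Sum>i\<in>I. 2 * K + 1)"
    by (rule sum_mono) auto
  also have "\<dots> = card I * (2 * K + 1)" by simp
  also have "\<dots> \<le> card X * (2 * K + 1)"
    using cI by (rule mult_le_mono1)
  also have "\<dots> < card {..<M - K}"
    using card by simp
  \<comment> \<open>The margin \<open>K\<close> keeps \<open>t + n\<close> below \<open>M\<close>
    for \<open>n \<le> K\<close>, the range covered by \<open>I\<close>.\<close>
  finally have "\<not> {..<M - K} \<subseteq> (\<Union>i\<in>I. {i - K..i + K})"
    using card_mono[of "\<Union>i\<in>I. {i - K..i + K}" "{..<M - K}"] fin by auto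
  then obtain t where t: "t < M - K" and nI: "\<And>i. i \<in> I \<Longrightarrow> t \<notin> {i - K..i + K}"
    by blast
  show thesis
  proof (rule that[of "(f ^^ t) b"])
    show "(f ^^ t) b \<in> U" by (simp add: funpow_closed b_in)
    show "(f ^^ n) ((f ^^ t) b) \<noteq> z" if "n \<le> K" "z \<in> X" for n z
    proof
      assume "(f ^^ n) ((f ^^ t) b) = z"
      then have "t + n \<in> I"
        using that t by (auto simp: I_def funpow_add add.commute[of t])
      from nI[OF this] show False using that by simp
    qed
    show "(f ^^ n) z \<noteq> (f ^^ t) b" if "n \<le> K" "z \<in> X" "z \<in> U" for n z
    proof
      assume "(f ^^ n) z = (f ^^ t) b"
      from funpow_eq_orbit_b[OF that(3) _ this] have "n \<le> t" "z = (f ^^ (t - n)) b"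
        using t by auto
      then have "t - n \<in> I" using that t by (auto simp: I_def)
      from nI[OF this] show False using that \<open>n \<le> t\<close> by auto
    qed
  qed
qed

text \<open>Each answer depends on \<open>n\<close> alone, so any two such structures agree on their
  special points. The slack \<open>2\<close> gives \<open>Suc n < M\<close>: hitting
  \<open>d\<close> or \<open>e\<close> means hitting \<open>c\<close> one step later.\<close>

lemma funpow_special_iff:
  assumes "n + 2 \<le> M"
  shows "(f ^^ n) b = b \<longleftrightarrow> n = 0" "(f ^^ n) b \<noteq> c" "(f ^^ n) b \<noteq> d" "(f ^^ n) b \<noteq> e"
    "(f ^^ n) c \<noteq> b" "(f ^^ n) c = c \<longleftrightarrow> n = 0" "(f ^^ n) c \<noteq> d" "(f ^^ n) c \<noteq> e"
    "(f ^^ n) d \<noteq> b" "(f ^^ n) d = c \<longleftrightarrow> n = 1" "(f ^^ n) d = d \<longleftrightarrow> n = 0" "(f ^^ n) d \<noteq> e"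
    "(f ^^ n) e \<noteq> b" "(f ^^ n) e = c \<longleftrightarrow> n = 1" "(f ^^ n) e \<noteq> d" "(f ^^ n) e = e \<longleftrightarrow> n = 0"
proof -
  have bc: "(f ^^ n) b \<noteq> c" "f ((f ^^ n) b) \<noteq> c" "b \<noteq> c" "f b \<noteq> c"
    using b_far_c[of n] b_far_c[of "Suc n"] b_far_c[of 0] b_far_c[of 1] assms by auto
  have cc: "(f ^^ n) c = c \<longleftrightarrow> n = 0" "f ((f ^^ n) c) \<noteq> c"
    using no_short_cycle[OF c_in, of n] no_short_cycle[OF c_in, of "Suc n"] assms by auto
  have ne: "d \<noteq> c" "e \<noteq> c"
    using no_short_cycle[OF c_in, of 1] assms f_d f_e by auto
  have pre: "(f ^^ n) z = (f ^^ (n - 1)) c" if "f z = c" "0 < n" for z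
    using that by (cases n) (auto simp: funpow_swap1)
  have ret: "(f ^^ (n - 1)) c = c \<longleftrightarrow> n \<le> 1"
    using no_short_cycle[OF c_in, of "n - 1"] assms by (cases "n \<le> 1") auto
  have ret': "(f ^^ (n - 1)) c \<noteq> z" if "f z = c" "0 < n" for z
  proof
    assume "(f ^^ (n - 1)) c = z"
    then have "(f ^^ n) c = c" using that by (cases n) auto
    then show False using cc(1) that(2) by simp
  qed
  show "(f ^^ n) b = b \<longleftrightarrow> n = 0"
    using funpow_neq_b[OF b_in, of n] by (cases "n = 0") simp_all
  show "(f ^^ n) b \<noteq> c" by (rule bc(1))
  show "(f ^^ n) b \<noteq> d" "(f ^^ n) b \<noteq> e"
    using bc(2) f_d f_e by metis+
  show "(f ^^ n) c = c \<longleftrightarrow> n = 0" by (rule cc(1))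
  show "(f ^^ n) c \<noteq> d" "(f ^^ n) c \<noteq> e"
    using cc(2) f_d f_e by metis+
  have neq: "c \<noteq> b" "d \<noteq> b" "e \<noteq> b"
    using bc(3,4) f_d f_e by metis+
  show "(f ^^ n) c \<noteq> b" "(f ^^ n) d \<noteq> b" "(f ^^ n) e \<noteq> b"
    using funpow_neq_b[OF c_in, of n] funpow_neq_b[OF d_in, of n] funpow_neq_b[OF e_in, of n] neq
    by (cases "n = 0"; simp)+
  have to_c: "(f ^^ n) z = c \<longleftrightarrow> n = 1" if "f z = c" "z \<noteq> c" for z
    using pre[OF that(1)] ret that(2) by (cases "n = 0") (simp_all add: le_Suc_eq)
  show "(f ^^ n) d = c \<longleftrightarrow> n = 1" "(f ^^ n) e = c \<longleftrightarrow> n = 1"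
    by (rule to_c[OF f_d ne(1)], rule to_c[OF f_e ne(2)])
  show "(f ^^ n) d = d \<longleftrightarrow> n = 0" "(f ^^ n) e = e \<longleftrightarrow> n = 0" "(f ^^ n) d \<noteq> e" "(f ^^ n) e \<noteq> d"
    using pre[OF f_d] pre[OF f_e] ret'[OF f_d] ret'[OF f_e] d_neq_e
    by (cases "n = 0"; simp)+
qed

end

section \<open>Back and forth\<close>

text \<open>The instance \<open>n = 0\<close> makes \<open>R\<close> the graph of a partial
  injection. A relation is used so that exchanging the structures is just taking the
  converse.\<close>

definition similar :: "('a \<Rightarrow> 'a) \<Rightarrow> ('b \<Rightarrow> 'b) \<Rightarrow> nat \<Rightarrow> ('a \<times> 'b) set \<Rightarrow> bool" where
  "similar f g K R \<longleftrightarrow> (\<forall>x y x' y' n. (x, y) \<in> R \<longrightarrow> (x', y') \<in> R \<longrightarrow> n \<le> K \<longrightarrow>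
     ((f ^^ n) x = x' \<longleftrightarrow> (g ^^ n) y = y'))"

lemma similarD:
  "\<lbrakk>similar f g K R; (x, y) \<in> R; (x', y') \<in> R; n \<le> K\<rbrakk> \<Longrightarrow> (f ^^ n) x = x' \<longleftrightarrow> (g ^^ n) y = y'"
  unfolding similar_def by iprover

lemma similar_mono: "\<lbrakk>similar f g K R; K' \<le> K\<rbrakk> \<Longrightarrow> similar f g K' R"
  unfolding similar_def by (iprover intro: order.trans)

lemma similar_converse: "similar g f K (R\<inverse>) \<longleftrightarrow> similar f g K R"
  unfolding similar_def converse_iff by iprover

locale lollipop_pair =
  L: lollipop U f b c d e M + R: lollipop V g b' c' d' e' M
  for U :: "'a set" and f b c d e and V :: "'b set" and g b' c' d' e' and M
begin

text \<open>The opening position of the game; keeping these pairs in \<open>R\<close> lets the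
  invariant see the merging point and the point without preimage.\<close>

definition special :: "('a \<times> 'b) set" where
  "special = {(b, b'), (c, c'), (d, d'), (e, e')}"

lemma similar_special: "K + 2 \<le> M \<Longrightarrow> similar f g K special"
  by (auto simp: similar_def special_def L.funpow_special_iff R.funpow_special_iff)

text \<open>The new pair needs no check against itself: as \<open>K < M\<close> excludes short
  cycles, both sides hold exactly for \<open>n = 0\<close>.\<close>

lemma similar_insert:
  assumes "similar f g K R" "K < M" "x \<in> U" "y \<in> V"
    and "\<And>n x' y'. \<lbrakk>n \<le> K; (x', y') \<in> R\<rbrakk> \<Longrightarrow> (f ^^ n) x = x' \<longleftrightarrow> (g ^^ n) y = y'"
    and "\<And>n x' y'. \<lbrakk>n \<le> K; (x', y') \<in> R\<rbrakk> \<Longrightarrow> (f ^^ n) x' = x \<longleftrightarrow> (g ^^ n) y' = y"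
  shows "similar f g K (insert (x, y) R)"
proof -
  have self: "(f ^^ n) x = x \<longleftrightarrow> (g ^^ n) y = y" if "n \<le> K" for n
    using L.no_short_cycle[OF assms(3), of n] R.no_short_cycle[OF assms(4), of n] assms(2) that
    by (cases "n = 0") auto
  have "(f ^^ n) u = u' \<longleftrightarrow> (g ^^ n) v = v'"
    if n: "n \<le> K" and "(u, v) \<in> insert (x, y) R" "(u', v') \<in> insert (x, y) R" for n u v u' v'
    using that(2,3) self[OF n] assms(5,6)[OF n] similarD[OF assms(1) _ _ n]
    by (elim insertE) simp_all
  then show ?thesis
    unfolding similar_def by iprover
qed

text \<open>\<open>funpow_eq_iff\<close> reduces both sides to conditions that the invariant
  transfers; the merging case uses the pair \<open>(c, c')\<close>.\<close>

lemma similar_funpow_eq_iff: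
  assumes "similar f g K R" "(c, c') \<in> R" "R \<subseteq> U \<times> V"
    and "(x, y) \<in> R" "(x', y') \<in> R" "l \<le> K" "n \<le> K"
  shows "(f ^^ l) x = (f ^^ n) x' \<longleftrightarrow> (g ^^ l) y = (g ^^ n) y'"
proof -
  have U: "x \<in> U" "x' \<in> U" and V: "y \<in> V" "y' \<in> V"
    using assms by auto
  have "(f ^^ (n - l)) x' = x \<longleftrightarrow> (g ^^ (n - l)) y' = y"
    "(f ^^ (l - n)) x = x' \<longleftrightarrow> (g ^^ (l - n)) y = y'"
    "\<And>k. (f ^^ (l - k)) x = c \<longleftrightarrow> (g ^^ (l - k)) y = c'"
    "\<And>k. (f ^^ (n - k)) x' = c \<longleftrightarrow> (g ^^ (n - k)) y' = c'"
    by (rule similarD[OF assms(1)]; use assms(2-) in simp)+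
  then show ?thesis
    unfolding L.funpow_eq_iff[OF U] R.funpow_eq_iff[OF V] by simp
qed

text \<open>One round of the game: \<open>x\<close> is reached from \<open>R\<close> within
  \<open>K\<close> steps, or only reaches \<open>R\<close> within \<open>K\<close> steps, or is far
  from \<open>R\<close>. The first two cases add two distances up to \<open>K\<close>, whence the
  radius \<open>2 * K\<close>; the last needs room to find a far point.\<close>

lemma forth:
  assumes sim: "similar f g (2 * K) R" and sp: "special \<subseteq> R" and RUV: "R \<subseteq> U \<times> V"
    and fin: "finite R" and card: "card R * (2 * K + 1) + K < M" and x: "x \<in> U"
  obtains y where "y \<in> V" "similar f g K (insert (x, y) R)"
proof -
  have sim': "similar f g K R" using sim by (rule similar_mono) simp
  have cR: "(c, c') \<in> R" and bR: "(b, b') \<in> R" and dR: "(d, d') \<in> R" and eR: "(e, e') \<in> R"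
    using sp by (auto simp: special_def)
  have KM: "K < M" using card by simp
  consider (orbit) n x1 y1 where "n \<le> K" "(x1, y1) \<in> R" "(f ^^ n) x1 = x"
    | (preimage) "\<exists>n\<le>K. (f ^^ n) x \<in> Domain R" "\<And>n x1. \<lbrakk>n \<le> K; x1 \<in> Domain R\<rbrakk> \<Longrightarrow> (f ^^ n) x1 \<noteq> x"
    | (far) "\<And>n. n \<le> K \<Longrightarrow> (f ^^ n) x \<notin> Domain R" "\<And>n x1. \<lbrakk>n \<le> K; x1 \<in> Domain R\<rbrakk> \<Longrightarrow> (f ^^ n) x1 \<noteq> x"
    by blast
  then show thesis
  proof cases
    case orbit
    have y1: "y1 \<in> V" using orbit RUV by auto
    note iff = similar_funpow_eq_iff[OF sim cR RUV]
    have x: "x = (f ^^ n) x1" using orbit by simp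
    have y: "(g ^^ n) y1 \<in> V" by (simp add: R.funpow_closed y1)
    show thesis
    proof (rule that[OF y], rule similar_insert[OF sim' KM \<open>x \<in> U\<close> y])
      fix l x' y' assume l: "l \<le> K" and R: "(x', y') \<in> R"
      show "(f ^^ l) x = x' \<longleftrightarrow> (g ^^ l) ((g ^^ n) y1) = y'"
        using iff[OF orbit(2) R, of "l + n" 0] l orbit(1) by (simp add: x funpow_add)
      show "(f ^^ l) x' = x \<longleftrightarrow> (g ^^ l) y' = (g ^^ n) y1"
        using iff[OF R orbit(2), of l n] l orbit(1) by (simp add: x)
    qed
  next
    case preimage
    \<comment> \<open>The reply has to enter \<open>R\<close> at the same time as \<open>x\<close>,
      at the partner of its first entry point.\<close>
    define n where "n = (LEAST n. (f ^^ n) x \<in> Domain R)"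
    have "(f ^^ n) x \<in> Domain R"
      unfolding n_def using preimage(1) by (auto intro: LeastI)
    then obtain y1 where xy1: "((f ^^ n) x, y1) \<in> R" by auto
    have least: "(f ^^ m) x \<notin> Domain R" if "m < n" for m
      using that not_less_Least unfolding n_def by blast
    obtain n' where n': "n' \<le> K" "(f ^^ n') x \<in> Domain R" using preimage(1) by auto
    then have nK: "n \<le> K"
      using Least_le[of "\<lambda>n. (f ^^ n) x \<in> Domain R" n'] unfolding n_def by simp
    have n0: "0 < n" using preimage(2)[of 0 x] xy1 by (cases n) auto
    have y1: "y1 \<in> V" using xy1 RUV by auto
    \<comment> \<open>If the entry point were \<open>c\<close>, its predecessor \<open>d\<close> or
      \<open>e\<close> would be an earlier entry.\<close>
    have fnx: "(f ^^ n) x \<noteq> c"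
    proof
      assume "(f ^^ n) x = c"
      then have "f ((f ^^ (n - 1)) x) = c" using n0 by (cases n) auto
      then have "(f ^^ (n - 1)) x = d \<or> (f ^^ (n - 1)) x = e"
        by (rule L.pre_c[OF L.funpow_closed[OF x]])
      then show False using least[of "n - 1"] n0 dR eR by auto
    qed
    have path: "(f ^^ t) x \<noteq> c" if "t \<le> n" for t
      using that least[of t] cR fnx by (cases "t = n") auto
    \<comment> \<open>Since the path from \<open>x\<close> to its entry point avoids
      \<open>c\<close>, it is the only way back from there.\<close>
    have cancel: "x' = (f ^^ (n - t)) x"
      if "x' \<in> U" "t \<le> n" "(f ^^ t) x' = (f ^^ n) x" for x' t
    proof -
      have shift: "(f ^^ s) ((f ^^ (n - t)) x) = (f ^^ (n - (t - s))) x" if "s \<le> t" for s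
        using that \<open>t \<le> n\<close> by (simp flip: funpow_add comp_apply[of "f ^^ s"] add: add.commute)
      have "(f ^^ (n - t)) x = x'"
      proof (rule L.funpow_cancel[of _ _ t])
        show "(f ^^ t) ((f ^^ (n - t)) x) = (f ^^ t) x'"
          using that shift[of t] by simp
      qed (use that path shift x in \<open>auto simp: L.funpow_closed\<close>)
      then show ?thesis ..
    qed
    \<comment> \<open>Walk back from \<open>y1\<close>. Getting stuck at \<open>b'\<close> would, by
      similarity, put \<open>b\<close> on the path of \<open>x\<close> at a positive time, but
      \<open>b\<close> has no preimage.\<close>
    have "\<exists>y\<in>V. (g ^^ t) y = y1" if "t \<le> n" for t
      using that
    proof (induction t)
      case (Suc t)
      then obtain y where y: "y \<in> V" "(g ^^ t) y = y1" by auto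
      have "y \<noteq> b'"
      proof
        assume "y = b'"
        then have "(f ^^ t) b = (f ^^ n) x"
          using similarD[OF sim' bR xy1, of t] y Suc.prems nK by simp
        from cancel[OF L.b_in _ this] have "(f ^^ (n - t)) x = b"
          using Suc.prems by simp
        then show False
          using L.funpow_neq_b[OF x, of "n - t"] Suc.prems by simp
      qed
      then obtain z where "z \<in> V" "g z = y" using R.pre_ex y by auto
      then show ?case using y by (auto simp: funpow_swap1 intro!: bexI[of _ z])
    qed (use y1 in auto)
    then obtain y where y: "y \<in> V" and gy: "(g ^^ n) y = y1" by blast
    \<comment> \<open>A meeting of \<open>y\<close> with \<open>R\<close> before time
      \<open>n\<close> would transfer to one of \<open>x\<close>.\<close>
    have yleast: "(g ^^ s) y \<noteq> y'" if "s < n" "(x', y') \<in> R" for s x' y'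
    proof
      assume "(g ^^ s) y = y'"
      moreover have "(g ^^ (n - s)) ((g ^^ s) y) = (g ^^ n) y"
        using that(1) by (simp flip: funpow_add comp_apply[of "g ^^ (n - s)"])
      ultimately have "(g ^^ (n - s)) y' = y1" using gy by simp
      then have "(f ^^ (n - s)) x' = (f ^^ n) x"
        using similarD[OF sim' that(2) xy1, of "n - s"] nK by simp
      then have "x' = (f ^^ s) x"
        using cancel[of x' "n - s"] that RUV by auto
      then show False using least that by blast
    qed
    have "y1 \<noteq> c'" using similarD[OF sim' xy1 cR, of 0] fnx by simp
    then have ypath: "(g ^^ t) y \<noteq> c'" if "t \<le> n" for t
      using that yleast[OF _ cR, of t] gy by (cases "t = n") auto
    show thesis
    proof (rule that[OF y], rule similar_insert[OF sim' KM x y])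
      fix l x' y' assume l: "l \<le> K" and R: "(x', y') \<in> R"
      show "(f ^^ l) x = x' \<longleftrightarrow> (g ^^ l) y = y'"
      proof (cases "l < n")
        case True
        then show ?thesis using least[OF True] yleast[OF True R] R by blast
      next
        case False
        have "(f ^^ l) x = (f ^^ (l - n)) ((f ^^ n) x)" "(g ^^ l) y = (g ^^ (l - n)) y1"
          using False by (simp_all flip: gy funpow_add comp_apply[of "f ^^ (l - n)"]
              comp_apply[of "g ^^ (l - n)"])
        then show ?thesis
          using similarD[OF sim' xy1 R, of "l - n"] l by simp
      qed
      \<comment> \<open>Otherwise \<open>y'\<close> leads to \<open>y1\<close> in
        \<open>n + l \<le> 2 * K\<close> steps; transferring this and cancelling the last
        \<open>n\<close> steps, \<open>x'\<close> leads to \<open>x\<close>, which this case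
        excludes.\<close>
      have "(g ^^ l) y' \<noteq> y"
      proof
        assume "(g ^^ l) y' = y"
        then have "(g ^^ (n + l)) y' = y1" using gy by (simp add: funpow_add)
        then have "(f ^^ (n + l)) x' = (f ^^ n) x"
          using similarD[OF sim R xy1, of "n + l"] nK l by simp
        then have "(f ^^ n) ((f ^^ l) x') = (f ^^ n) x" by (simp add: funpow_add)
        then have "(f ^^ l) x' = x"
          using cancel[of "(f ^^ l) x'" n] R RUV by (auto simp: L.funpow_closed)
        then show False using preimage(2)[OF l] R by blast
      qed
      then show "(f ^^ l) x' = x \<longleftrightarrow> (g ^^ l) y' = y"
        using preimage(2)[OF l] R by blast
    qed
  next
    case far
    have "card (Range R) \<le> card R"
      using fin by (simp add: Range_snd card_image_le)
    then have "card (Range R) * (2 * K + 1) + K < M"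
      using card mult_le_mono1[of "card (Range R)" "card R" "2 * K + 1"] by simp
    then obtain y where y: "y \<in> V"
      and y1: "\<And>n z. \<lbrakk>n \<le> K; z \<in> Range R\<rbrakk> \<Longrightarrow> (g ^^ n) y \<noteq> z"
      and y2: "\<And>n z. \<lbrakk>n \<le> K; z \<in> Range R; z \<in> V\<rbrakk> \<Longrightarrow> (g ^^ n) z \<noteq> y"
      using R.far_element[OF finite_Range[OF fin]] by metis
    show thesis
    proof (rule that[OF y], rule similar_insert[OF sim' KM x y])
      fix l x' y' assume l: "l \<le> K" and R: "(x', y') \<in> R"
      show "(f ^^ l) x = x' \<longleftrightarrow> (g ^^ l) y = y'"
        using far(1)[OF l] y1[OF l] R by blast
      show "(f ^^ l) x' = x \<longleftrightarrow> (g ^^ l) y' = y"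
        using far(2)[OF l] y2[OF l] R RUV by blast
    qed
  qed
qed

lemma swap: "lollipop_pair V g b' c' d' e' U f b c d e M"
  by unfold_locales

end

section \<open>Bounds read off a formula, and transfer of truth\<close>

fun tm_root :: "'v tm \<Rightarrow> 'v" where
  "tm_root (Var x) = x"
| "tm_root (Fn t) = tm_root t"

fun tm_depth :: "'v tm \<Rightarrow> nat" where
  "tm_depth (Var x) = 0"
| "tm_depth (Fn t) = Suc (tm_depth t)"

lemma eval_tm_funpow: "eval_tm S \<sigma> t = (func S ^^ tm_depth t) (\<sigma> (tm_root t))"
  by (induction t) auto

lemma tm_vars_tm_root: "tm_vars t = {tm_root t}"
  by (induction t) auto

text \<open>The similarity radius that the game needs: atoms compare iterates up to their depth, and
  \<open>forth\<close> halves the radius at each quantifier.\<close>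

primrec radius :: "fm \<Rightarrow> nat" where
  "radius (Eq s t) = max (tm_depth s) (tm_depth t)"
| "radius (Neg \<phi>) = radius \<phi>"
| "radius (Conj \<phi> \<psi>) = max (radius \<phi>) (radius \<psi>)"
| "radius (Ex x \<phi>) = 2 * radius \<phi>"

primrec rank :: "fm \<Rightarrow> nat" where
  "rank (Eq s t) = 0"
| "rank (Neg \<phi>) = rank \<phi>"
| "rank (Conj \<phi> \<psi>) = max (rank \<phi>) (rank \<psi>)"
| "rank (Ex x \<phi>) = Suc (rank \<phi>)"

text \<open>Induction on the formula, a quantifier being one round of the game. Each round lowers
  \<open>rank\<close> by one and adds at most one pair, so bounding the sum of \<open>card R\<close>
  and \<open>rank \<phi>\<close> leaves room for all later rounds.\<close>

lemma (in lollipop_pair) sat_iff: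
  assumes "univ S = U" "func S = f" "univ T = V" "func T = g"
    and "similar f g (radius \<phi>) R" "special \<subseteq> R" "R \<subseteq> U \<times> V" "finite R"
    and "(card R + rank \<phi>) * (2 * radius \<phi> + 1) + radius \<phi> < M"
    and "\<And>x. x \<in> free_vars \<phi> \<Longrightarrow> (\<sigma> x, \<tau> x) \<in> R"
  shows "sat S \<sigma> \<phi> \<longleftrightarrow> sat T \<tau> \<phi>"
  using assms(5-)
proof (induction \<phi> arbitrary: R \<sigma> \<tau>)
  case (Eq s t)
  have "(c, c') \<in> R" using Eq.prems(2) by (auto simp: special_def)
  moreover have "(\<sigma> (tm_root s), \<tau> (tm_root s)) \<in> R" "(\<sigma> (tm_root t), \<tau> (tm_root t)) \<in> R"
    using Eq.prems(6) by (simp_all add: tm_vars_tm_root)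
  ultimately show ?case
    using similar_funpow_eq_iff[OF Eq.prems(1) _ Eq.prems(3)] assms(1-4)
    by (simp add: eval_tm_funpow)
next
  case (Neg \<phi>)
  show ?case using Neg.IH[of R \<sigma> \<tau>] Neg.prems by simp
next
  case (Conj \<phi> \<psi>)
  let ?k = "max (radius \<phi>) (radius \<psi>)" and ?q = "max (rank \<phi>) (rank \<psi>)"
  have le: "(card R + q) * (2 * k + 1) + k < M" if "k \<le> ?k" "q \<le> ?q" for k q
  proof -
    have "(card R + q) * (2 * k + 1) + k \<le> (card R + ?q) * (2 * ?k + 1) + ?k"
      using that by (intro add_mono mult_le_mono) auto
    then show ?thesis using Conj.prems(5) by simp
  qed
  have "similar f g (radius \<phi>) R" "similar f g (radius \<psi>) R"
    using Conj.prems(1) by (rule similar_mono; simp)+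
  then have "sat S \<sigma> \<phi> \<longleftrightarrow> sat T \<tau> \<phi>" "sat S \<sigma> \<psi> \<longleftrightarrow> sat T \<tau> \<psi>"
    using Conj.prems(6) by (intro Conj.IH[OF _ Conj.prems(2-4)] le; simp)+
  then show ?case by simp
next
  case (Ex x \<phi>)
  let ?k = "radius \<phi>"
  have bound: "(Suc (card R) + rank \<phi>) * (2 * ?k + 1) + ?k < M"
  proof -
    have "(Suc (card R) + rank \<phi>) * (2 * ?k + 1) + ?k
        \<le> (card R + rank (Ex x \<phi>)) * (2 * radius (Ex x \<phi>) + 1) + radius (Ex x \<phi>)"
      by (rule add_mono[OF mult_le_mono]) auto
    then show ?thesis using Ex.prems(5) by simp
  qed
  have bound': "card R * (2 * ?k + 1) + ?k < M"
    using bound by (simp add: algebra_simps)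
  have step: "sat S (\<sigma>(x := u)) \<phi> \<longleftrightarrow> sat T (\<tau>(x := v)) \<phi>"
    if "similar f g ?k (insert (u, v) R)" "u \<in> U" "v \<in> V" for u v
  proof (rule Ex.IH[of "insert (u, v) R"])
    have "(card (insert (u, v) R) + rank \<phi>) * (2 * ?k + 1) + ?k
        \<le> (Suc (card R) + rank \<phi>) * (2 * ?k + 1) + ?k"
      using Ex.prems(4) by (intro add_mono mult_le_mono) (auto simp: card_insert_if)
    then show "(card (insert (u, v) R) + rank \<phi>) * (2 * ?k + 1) + ?k < M"
      using bound by simp
    show "((\<sigma>(x := u)) y, (\<tau>(x := v)) y) \<in> insert (u, v) R" if "y \<in> free_vars \<phi>" for y
      using Ex.prems(6)[of y] that by (cases "y = x") simp_all
  qed (use that Ex.prems(2-4) in blast)+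
  show ?case
  proof
    assume "sat S \<sigma> (Ex x \<phi>)"
    then obtain u where u: "u \<in> U" "sat S (\<sigma>(x := u)) \<phi>"
      unfolding sat.simps assms(1) by (rule bexE)
    from Ex.prems(1) have "similar f g (2 * ?k) R" by simp
    then obtain v where v: "v \<in> V" "similar f g ?k (insert (u, v) R)"
      by (rule forth[OF _ Ex.prems(2-4) bound' u(1)])
    from step[OF v(2) u(1) v(1)] u(2) have "sat T (\<tau>(x := v)) \<phi>" by iprover
    with v(1) show "sat T \<tau> (Ex x \<phi>)"
      by (simp only: sat.simps assms(3)) (rule bexI)
  next
    assume "sat T \<tau> (Ex x \<phi>)"
    then obtain v where v: "v \<in> V" "sat T (\<tau>(x := v)) \<phi>"
      unfolding sat.simps assms(3) by (rule bexE)
    \<comment> \<open>The back move is the forth move with the structures exchanged and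
      \<open>R\<close> reversed.\<close>
    interpret swapped: lollipop_pair V g b' c' d' e' U f b c d e M by (rule swap)
    have sim: "similar g f (2 * ?k) (R\<inverse>)"
      using Ex.prems(1) by (simp add: similar_converse)
    have special: "swapped.special \<subseteq> R\<inverse>"
      using Ex.prems(2) by (auto simp: swapped.special_def special_def)
    have R: "R\<inverse> \<subseteq> V \<times> U" "finite (R\<inverse>)"
      using Ex.prems(3,4) by auto
    have "card (R\<inverse>) * (2 * ?k + 1) + ?k < M"
      using bound' by (simp only: card_inverse)
    then obtain u where u: "u \<in> U" "similar g f ?k (insert (v, u) (R\<inverse>))"
      by (rule swapped.forth[OF sim special R _ v(1)])
    have "insert (v, u) (R\<inverse>) = (insert (u, v) R)\<inverse>" by auto
    with u(2) have "similar f g ?k (insert (u, v) R)" by (simp only: similar_converse)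
    from step[OF this u(1) v(1)] v(2) have "sat S (\<sigma>(x := u)) \<phi>" by iprover
    with u(1) show "sat S \<sigma> (Ex x \<phi>)"
      by (simp only: sat.simps assms(1)) (rule bexI)
  qed
qed

text \<open>\<open>sat_iff\<close> at the opening position, whose at most four pairs give the
  \<open>4\<close>. A sentence has no free variables, so the two assignments may be
  unrelated.\<close>

lemma (in lollipop_pair) models_transfer:
  assumes "univ S = U" "func S = f" "univ T = V" "func T = g"
    and "sentence \<phi>" "models S \<phi>"
    and "(4 + rank \<phi>) * (2 * radius \<phi> + 1) + radius \<phi> < M"
  shows "models T \<phi>"
  unfolding models_def
proof (intro allI impI)
  fix \<tau> :: "nat \<Rightarrow> 'b" assume "range \<tau> \<subseteq> univ T"
  have "card special \<le> 4"
    unfolding special_def by (simp add: card_insert_if)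
  then have "(card special + rank \<phi>) * (2 * radius \<phi> + 1) + radius \<phi>
      \<le> (4 + rank \<phi>) * (2 * radius \<phi> + 1) + radius \<phi>"
    by (intro add_mono mult_le_mono) auto
  moreover have "radius \<phi> + 2 \<le> M"
    using assms(7) by (simp add: algebra_simps)
  then have "similar f g (radius \<phi>) special" by (rule similar_special)
  moreover have "special \<subseteq> U \<times> V"
    by (auto simp: special_def L.b_in L.c_in L.d_in L.e_in R.b_in R.c_in R.d_in R.e_in)
  moreover have "finite special" by (simp add: special_def)
  moreover have "sat S (\<lambda>_. c) \<phi>"
    using assms(6) by (auto simp: models_def assms(1) L.c_in)
  ultimately show "sat T \<tau> \<phi>"
    using sat_iff[of S T \<phi> special "\<lambda>_. c" \<tau>] assms by (auto simp: sentence_def)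
qed

section \<open>The limit structure and the presented structures\<close>

lemma limit_func_funpow:
  "(limit_func ^^ n) (B i) = B (i + n)" "(limit_func ^^ n) (C i) = C (i + n)"
  by (induction n) auto

lemma limit_func_funpow_D:
  "0 < i \<Longrightarrow> (limit_func ^^ n) (D i) = (if n < i then D (i - n) else C (n - i))"
  by (induction n) auto

lemma limit_func_funpow_E:
  "0 < i \<Longrightarrow> (limit_func ^^ n) (E i) = (if n < i then E (i - n) else C (n - i))"
  by (induction n) auto

text \<open>True for every \<open>M\<close>, as \<open>B 0\<close> never reaches \<open>C 0\<close>
  and there are no cycles at all.\<close>

lemma lollipop_limit_struct:
  "lollipop (univ limit_struct) (func limit_struct) (B 0) (C 0) (D 1) (E 1) M"
proof (unfold limit_struct_def struct.simps, standard, goal_cases)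
  case (11 u)
  then show ?case by (cases u) auto
next
  case (12 u)
  show ?case
  proof (cases u)
    case (B i)
    then show ?thesis using 12 by (intro bexI[of _ "B (i - 1)"]) auto
  next
    case (C i)
    then show ?thesis
      by (intro bexI[of _ "if i = 0 then D 1 else C (i - 1)"]) auto
  next
    case (D i)
    then show ?thesis using 12 by (intro bexI[of _ "D (i + 1)"]) auto
  next
    case (E i)
    then show ?thesis using 12 by (intro bexI[of _ "E (i + 1)"]) auto
  qed
next
  case (14 x n)
  then show ?case
    by (cases x) (auto simp: limit_func_funpow limit_func_funpow_D limit_func_funpow_E split: if_splits)
qed (auto simp: limit_func_funpow split: if_splits)

section \<open>The structure presented by one identity\<close>

lemma one_identity_commute: "one_identity r r' = one_identity r' r"
proof -
  have "conseq {(s, t)} u v" if "conseq {(t, s)} u v" for s t u v :: "unit tm"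
    using that
  proof induction
    case (ax u v)
    then show ?case using conseq.sym[OF conseq.ax[of s t "{(s, t)}"]] by simp
  next
    case (trans u v w)
    then show ?case by (blast intro: conseq.trans)
  qed (simp_all add: conseq.refl conseq.sym conseq.cong)
  then have "conseq_rel {(s, t)} = conseq_rel {(t, s)}" for s t :: "unit tm"
    unfolding conseq_rel_def by blast
  then show ?thesis by (simp add: one_identity_def presented_def)
qed

text \<open>The \<open>i\<close>-th iterate of the generator. Distinct indices may name the same
  element, as \<open>r\<close> and \<open>r'\<close> do.\<close>

definition orbit_class :: "nat \<Rightarrow> nat \<Rightarrow> nat \<Rightarrow> unit tm set" where
  "orbit_class r r' i = conseq_rel {((Fn ^^ r) (Var ()), (Fn ^^ r') (Var ()))} `` {(Fn ^^ i) (Var ())}"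

lemma func_orbit_class: "func (one_identity r r') (orbit_class r r' i) = orbit_class r r' (Suc i)"
  by (simp add: one_identity_def orbit_class_def func_presented_class)

lemma func_funpow_orbit_class:
  "(func (one_identity r r') ^^ n) (orbit_class r r' i) = orbit_class r r' (i + n)"
  by (induction n) (auto simp: func_orbit_class)

lemma orbit_class_eq_iff:
  "orbit_class r r' i = orbit_class r r' j \<longleftrightarrow>
     conseq {((Fn ^^ r) (Var ()), (Fn ^^ r') (Var ()))} ((Fn ^^ i) (Var ())) ((Fn ^^ j) (Var ()))"
  unfolding orbit_class_def using eq_equiv_class_iff[OF equiv_conseq_rel] by (simp add: conseq_rel_def)

lemma orbit_class_relation: "orbit_class r r' r' = orbit_class r r' r"
  unfolding orbit_class_eq_iff by (intro conseq.sym[OF conseq.ax] singletonI)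

lemma eval_tm_Fn_funpow: "eval_tm S \<sigma> ((Fn ^^ i) (Var x)) = (func S ^^ i) (\<sigma> x)"
  by (induction i) auto

text \<open>A tool for separating classes: by soundness, equal classes have equal values in every
  model of the identity on the naturals, with the generator read as \<open>0\<close>.\<close>

lemma orbit_class_sound:
  fixes g :: "nat \<Rightarrow> nat"
  assumes "orbit_class r r' i = orbit_class r r' j" "(g ^^ r) 0 = (g ^^ r') 0"
  shows "(g ^^ i) 0 = (g ^^ j) 0"
  using conseq_sound[OF assms(1)[unfolded orbit_class_eq_iff],
      of "\<lparr>univ = UNIV, func = g\<rparr>" "\<lambda>_. 0"] assms(2)
  by (simp add: eval_tm_Fn_funpow)

lemma orbit_class_mod:
  assumes "orbit_class r r' i = orbit_class r r' j" "r \<le> r'"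
  shows "i mod (r' - r) = j mod (r' - r)"
proof -
  \<comment> \<open>The model is a counter modulo the cycle length. For \<open>r = r'\<close> the
    modulus is \<open>0\<close>, \<open>mod\<close> returns its first argument, and the counter is
    the plain successor.\<close>
  let ?g = "\<lambda>i. Suc i mod (r' - r)"
  have g: "(?g ^^ n) 0 = n mod (r' - r)" for n
    by (induction n) (auto simp: mod_Suc_eq)
  have "r mod (r' - r) = r' mod (r' - r)"
    using assms(2) by (metis le_add_diff_inverse mod_add_self2)
  then show ?thesis
    using orbit_class_sound[OF assms(1), of ?g] by (simp add: g)
qed

lemma inj_on_orbit_class:
  assumes "r < r'"
  shows "inj_on (orbit_class r r') {..<r'}"
proof (rule inj_onI)
  fix i j assume ij: "i \<in> {..<r'}" "j \<in> {..<r'}" "orbit_class r r' i = orbit_class r r' j"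
  \<comment> \<open>The model is the expected shape: count up to \<open>r' - 1\<close>, then return
    to \<open>r\<close>. Both sides of the identity evaluate to \<open>r\<close>.\<close>
  let ?g = "\<lambda>i. if Suc i = r' then r else Suc i"
  have g: "(?g ^^ n) 0 = n" if "n < r'" for n
    using that by (induction n) auto
  have "(?g ^^ r') 0 = ?g ((?g ^^ (r' - 1)) 0)"
    using assms by (cases r') auto
  also have "\<dots> = r" using assms g[of "r' - 1"] by auto
  finally show "i = j"
    using orbit_class_sound[OF ij(3), of ?g] g ij assms by simp
qed

text \<open>Every term is an iterate of the generator, and an index that reaches \<open>r'\<close>
  can be replaced by \<open>r\<close>.\<close>

lemma univ_one_identity:
  assumes "r < r'"
  shows "univ (one_identity r r') = orbit_class r r' ` {..<r'}"
proof
  have tm: "\<exists>i. t = (Fn ^^ i) (Var ())" for t :: "unit tm"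
  proof (induction t)
    case (Fn t)
    then obtain i where "t = (Fn ^^ i) (Var ())" by blast
    then show ?case by (intro exI[of _ "Suc i"]) simp
  qed (auto intro: exI[of _ 0])
  have small: "orbit_class r r' i \<in> orbit_class r r' ` {..<r'}" for i
  proof (induction i)
    case 0
    then show ?case using assms by auto
  next
    case (Suc i)
    then obtain j where j: "j < r'" "orbit_class r r' i = orbit_class r r' j" by auto
    then have eq: "orbit_class r r' (Suc i) = orbit_class r r' (Suc j)"
      by (metis func_orbit_class)
    show ?case
    proof (cases "Suc j = r'")
      case True
      then show ?thesis using eq orbit_class_relation[of r r'] assms by auto
    next
      case False
      then show ?thesis using eq j(1) by auto
    qed
  qed
  show "univ (one_identity r r') \<subseteq> orbit_class r r' ` {..<r'}"
  proof
    fix X assume "X \<in> univ (one_identity r r')"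
    then obtain t where "X = conseq_rel {((Fn ^^ r) (Var ()), (Fn ^^ r') (Var ()))} `` {t}"
      by (auto simp: one_identity_def presented_def quotient_def)
    then show "X \<in> orbit_class r r' ` {..<r'}"
      using tm[of t] small by (auto simp: orbit_class_def)
  qed
  show "orbit_class r r' ` {..<r'} \<subseteq> univ (one_identity r r')"
    by (auto simp: one_identity_def presented_def orbit_class_def quotient_def)
qed

text \<open>Indices below \<open>r\<close> form the tail, those from \<open>r\<close> to
  \<open>r' - 1\<close> the cycle. The entry \<open>r\<close> is the image of the last tail point
  and of the last cycle point. Both lengths being at least \<open>M\<close> gives the two distance
  conditions.\<close>

lemma lollipop_one_identity:
  assumes M: "0 < M" "M \<le> r" "r + M \<le> r'"
  shows "lollipop (univ (one_identity r r')) (func (one_identity r r')) (orbit_class r r' 0)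
    (orbit_class r r' r) (orbit_class r r' (r - 1)) (orbit_class r r' (r' - 1)) M"
proof -
  let ?q = "orbit_class r r'" and ?f = "func (one_identity r r')"
  have r: "0 < r" "r < r'" using M by auto
  have q: "?q i = ?q j \<longleftrightarrow> i = j" if "i < r'" "j < r'" for i j
    using inj_on_orbit_class[OF r(2)] that by (auto simp: inj_on_def)
  have f: "?f (?q i) = ?q (if Suc i = r' then r else Suc i)" for i
    by (simp add: func_orbit_class orbit_class_relation)
  show ?thesis
  proof (unfold univ_one_identity[OF r(2)], standard, goal_cases)
    case (1 x)
    then show ?case using r by (auto simp: f)
  next
    case (6 u v)
    then obtain i j where "u = ?q i" "v = ?q j" "i < r'" "j < r'" by blast
    then show ?case using 6(3,4) r by (simp add: f q split: if_splits)
  next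
    case (7 u)
    then obtain i where "u = ?q i" "i < r'" by blast
    then show ?case using 7(2) r by (auto simp add: f q split: if_splits)
  next
    case (10)
    then show ?case using r by (simp add: q)
  next
    case (11 u)
    then obtain i where "u = ?q i" "i < r'" by blast
    then show ?case using r by (simp add: f q)
  next
    case (12 u)
    then obtain i where "u = ?q i" "i < r'" by blast
    moreover from this 12(2) have "0 < i" by (cases i) auto
    ultimately show ?case by (intro bexI[of _ "?q (i - 1)"]) (simp_all add: f)
  next
    case (13 n)
    then show ?case using M by (simp add: func_funpow_orbit_class q)
  next
    case (14 x n)
    then obtain i where i: "x = ?q i" by auto
    show ?case
    proof
      \<comment> \<open>A return after \<open>n\<close> steps makes the cycle length, at least
        \<open>M\<close>, divide \<open>n\<close>, against \<open>0 < n < M\<close>.\<close>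
      assume "(?f ^^ n) x = x"
      then have "(i + n) mod (r' - r) = i mod (r' - r)"
        using orbit_class_mod[of r r' "i + n" i] r by (simp add: i func_funpow_orbit_class)
      then have "r' - r dvd n"
        by (metis add_diff_cancel_left' le_add1 mod_eq_dvd_iff_nat)
      then show False using 14 M by (auto dest: dvd_imp_le)
    qed
  qed (use r in \<open>auto simp: f\<close>)
qed

text \<open>Transfer from the limit structure. The strict bound also makes \<open>M\<close>
  positive, and the case \<open>r > r'\<close> follows by swapping the sides of the
  identity.\<close>

lemma models_one_identity:
  assumes "sentence \<phi>" "models limit_struct \<phi>"
    and "(4 + rank \<phi>) * (2 * radius \<phi> + 1) + radius \<phi> < M"
    and "M \<le> r" "M \<le> r'" "r + M \<le> r' \<or> r' + M \<le> r"
  shows "models (one_identity r r') \<phi>"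
proof -
  have "models (one_identity i j) \<phi>" if "M \<le> i" "i + M \<le> j" for i j
  proof -
    interpret lollipop_pair "univ limit_struct" "func limit_struct" "B 0" "C 0" "D 1" "E 1"
      "univ (one_identity i j)" "func (one_identity i j)" "orbit_class i j 0"
      "orbit_class i j i" "orbit_class i j (i - 1)" "orbit_class i j (j - 1)" M
      using lollipop_limit_struct lollipop_one_identity assms(3) that
      by (intro lollipop_pair.intro) auto
    show ?thesis
      using models_transfer[OF HOL.refl HOL.refl HOL.refl HOL.refl] assms(1-3) by blast
  qed
  then show ?thesis
    using assms(4-6) one_identity_commute[of r r'] by metis
qed

section \<open>Counting identities\<close>

text \<open>Each \<open>r \<le> s\<close> allows \<open>s - r + 1\<close> values of
  \<open>r'\<close>; summed in reverse order these give a triangular number.\<close>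

lemma num_identities_ge: "(s + 1) * (s + 2) \<le> 2 * num_identities s"
proof -
  have eq: "{(r, r'). r + r' \<le> s} = (SIGMA r:{..s}. {..s - r})" by auto
  have "num_identities s = (\<Sum>r\<le>s. Suc (s - r))"
    unfolding num_identities_def eq by simp
  also have "\<dots> = (\<Sum>r\<le>s. Suc r)"
    by (rule sum.reindex_bij_witness[of _ "\<lambda>r. s - r" "\<lambda>r. s - r"]) auto
  also have "2 * \<dots> = (s + 1) * (s + 2)"
    by (induction s) auto
  finally show ?thesis by simp
qed

text \<open>The exceptions lie in four strips of width \<open>M\<close>, linearly many against
  quadratically many identities, so the ratio is squeezed to \<open>1\<close>.\<close>

lemma has_limiting_density_1:
  assumes "\<And>r r'. \<lbrakk>M \<le> r; M \<le> r'; r + M \<le> r' \<or> r' + M \<le> r\<rbrakk> \<Longrightarrow> models (one_identity r r') \<phi>"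
  shows "has_limiting_density \<phi> 1"
proof -
  have lower: "num_identities s \<le> num_identities_sat \<phi> s + 4 * M * (s + 1)" for s
  proof -
    let ?sat = "{(r, r'). r + r' \<le> s \<and> models (one_identity r r') \<phi>}"
    let ?P = "{..<M} \<times> {..s}"
    \<comment> \<open>In order, the strips cover \<open>r < M\<close>, \<open>r' < M\<close>,
      \<open>r \<le> r' < r + M\<close> and \<open>r' \<le> r < r' + M\<close>.\<close>
    define bad where "bad = ?P \<union> prod.swap ` ?P \<union> (\<lambda>(k, r). (r, r + k)) ` ?P \<union> (\<lambda>(k, r). (r + k, r)) ` ?P"
    have "models (one_identity r r') \<phi>" if le: "r + r' \<le> s" and nbad: "(r, r') \<notin> bad" for r r'
    proof (rule assms)
      show "M \<le> r" using le nbad by (auto simp: bad_def)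
      have "(r', r) \<notin> ?P"
        using nbad imageI[of "(r', r)" ?P prod.swap] by (auto simp: bad_def)
      then show "M \<le> r'" using le by auto
      show "r + M \<le> r' \<or> r' + M \<le> r"
      proof (rule ccontr)
        assume no: "\<not> ?thesis"
        have "(r, r') \<in> (\<lambda>(k, r). (r, r + k)) ` ?P" if "r \<le> r'"
          using no le that by (intro image_eqI[of _ _ "(r' - r, r)"]) auto
        moreover have "(r, r') \<in> (\<lambda>(k, r). (r + k, r)) ` ?P" if "r' \<le> r"
          using no le that by (intro image_eqI[of _ _ "(r - r', r')"]) auto
        ultimately have "(r, r') \<in> bad"
          using nat_le_linear[of r r'] unfolding bad_def Un_iff by iprover
        with nbad show False ..
      qed
    qed
    then have "{(r, r'). r + r' \<le> s} \<subseteq> ?sat \<union> bad" by blast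
    moreover have "finite bad" by (simp add: bad_def)
    moreover have "finite ?sat"
      by (rule finite_subset[OF _ finite_identities[of s]]) auto
    ultimately have "num_identities s \<le> card (?sat \<union> bad)"
      unfolding num_identities_def by (intro card_mono) auto
    also have "\<dots> \<le> card ?sat + card bad"
      by (rule card_Un_le)
    also have "card bad \<le> card ?P + card ?P + card ?P + card ?P"
      unfolding bad_def by (intro order.trans[OF card_Un_le] add_mono card_image_le order.refl) auto
    also have "\<dots> = 4 * M * (s + 1)" by simp
    finally show ?thesis by (simp add: num_identities_sat_def)
  qed
  have upper: "num_identities_sat \<phi> s \<le> num_identities s" for s
    unfolding num_identities_def num_identities_sat_def
    by (intro card_mono finite_identities) auto
  have pos: "0 < num_identities s" for s
    using num_identities_ge[of s] by (cases "num_identities s") auto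
  let ?q = "\<lambda>s. real (num_identities_sat \<phi> s) / real (num_identities s)"
  \<comment> \<open>\<open>4 * M * (s + 1)\<close> exceptions over at least
    \<open>(s + 1) * (s + 2) / 2\<close> identities.\<close>
  have lo: "1 - 8 * real M / real (s + 2) \<le> ?q s" for s
  proof -
    have "real (4 * M * (s + 1)) * real (s + 2) = 4 * real M * real ((s + 1) * (s + 2))"
      by (simp only: of_nat_mult of_nat_numeral mult.assoc)
    also have "\<dots> \<le> 4 * real M * real (2 * num_identities s)"
      by (intro mult_left_mono of_nat_mono num_identities_ge) simp
    finally have "real (4 * M * (s + 1)) / real (num_identities s) \<le> 8 * real M / real (s + 2)"
      using pos[of s] by (simp add: field_simps)
    moreover have "real (num_identities s) \<le> real (num_identities_sat \<phi> s) + real (4 * M * (s + 1))"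
      using lower[of s] by (simp only: of_nat_add[symmetric] of_nat_le_iff)
    then have "1 \<le> ?q s + real (4 * M * (s + 1)) / real (num_identities s)"
      using pos[of s] by (simp add: field_simps)
    ultimately show ?thesis by linarith
  qed
  have hi: "?q s \<le> 1" for s
    using upper[of s] pos[of s] by simp
  have lim: "(\<lambda>s. 1 - 8 * real M / real (s + 2)) \<longlonglongrightarrow> 1"
  proof -
    have "(\<lambda>s. 8 * real M / real (s + 2)) \<longlonglongrightarrow> 0"
      using LIMSEQ_ignore_initial_segment[OF lim_const_over_n[of "8 * real M"], of 2] by simp
    from tendsto_diff[OF tendsto_const this, of 1] show ?thesis by simp
  qed
  show ?thesis
    unfolding has_limiting_density_def
    by (rule real_tendsto_sandwich[OF always_eventually always_eventually lim tendsto_const])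
      (use lo hi in blast)+
qed

theorem proposition3p15:
  fixes \<phi> :: fm
  assumes "sentence \<phi>" and "models limit_struct \<phi>"
  shows "has_limiting_density \<phi> 1"
  \<comment> \<open>\<open>lessI\<close> fixes \<open>M\<close> as the successor of the bound read
    off \<open>\<phi>\<close>.\<close>
  using models_one_identity[OF assms lessI] by (rule has_limiting_density_1)

end
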